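(* Let $n\ge1$ be an integer, $Q=2n+2$, and $p,q>1$. Let $M_1,M_2:\mathbb R_+\times\mathbb R_+\to\mathbb R$ be bounded functions such that $0<M_1(\cdot,\cdot)\le C_1$ and $0<M_2(\cdot,\cdot)\le C_2$ for some constants $C_1,C_2$. Assume that $$Q\left(1-\frac1{pq}\right)\le 2\max\left\{1+\frac1q,\,1+\frac1p\right\}.$$ Then the system $$\begin{cases}-M_1\left(\int_{\mathbb H^n}|\nabla_{\mathbb H}u|^2dx,\int_{\mathbb H^n}|\Delta_{\mathbb H}u|^2dx\right)\Delta_{\mathbb H}u=|v|^q, & x\in\mathbb H^n,\\ -M_2\left(\int_{\mathbb H^n}|\nabla_{\mathbb H}v|^2dx,\int_{\mathbb H^n}|\Delta_{\mathbb H}v|^2dx\right)\Delta_{\mathbb H}v=|u|^p, & x\in\mathbb H^n,\end{cases}$$ does not have a global non-trivial weak solution $(u,v)$ (non-trivial: $(u,v)$ is not almost everywhere equal to $(0,0)$).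
   Context: $\mathbb R_+=[0,\infty)$. The Heisenberg group $\mathbb H^n$ is $\mathbb R^{2n+1}$ with points $x=(\xi,\tilde\xi,\tau)$, $\xi,\tilde\xi\in\mathbb R^n$, $\tau\in\mathbb R$, equipped with the vector fields $X_i=\partial_{\xi_i}+2\tilde\xi_i\partial_\tau$, $Y_i=\partial_{\tilde\xi_i}-2\xi_i\partial_\tau$ ($i=1,\dots,n$) and with Lebesgue measure $dx$; its homogeneous dimension is $Q=2n+2$ (dilations $\delta_\lambda(x)=(\lambda\xi,\lambda\tilde\xi,\lambda^2\tau)$). The horizontal gradient is $\nabla_{\mathbb H}=(X_1,\dots,X_n,Y_1,\dots,Y_n)$ and the Kohn-Laplacian is $\Delta_{\mathbb H}=\sum_{i=1}^n(X_i^2+Y_i^2)$. $S^2_2(\mathbb H^n)=\{u: u\in L^2(\mathbb H^n),\ |\nabla_{\mathbb H}u|\in L^2(\mathbb H^n),\ |\Delta_{\mathbb H}u|\in L^2(\mathbb H^n)\}$ (derivatives in the distributional sense). Definition. A pair $(u,v)$ with $u\in S^2_2(\mathbb H^n)\cap L^p(\mathbb H^n)$ and $v\in S^2_2(\mathbb H^n)\cap L^q(\mathbb H^n)$ is a weak solution of the system if $$\int_{\mathbb H^n}|v|^q\varphi\,dx=-\int_{\mathbb H^n}M_1\left(\int_{\mathbb H^n}|\nabla_{\mathbb H}u|^2dx,\int_{\mathbb H^n}|\Delta_{\mathbb H}u|^2dx\right)u\,\Delta_{\mathbb H}\varphi\,dx$$ and $$\int_{\mathbb H^n}|u|^p\psi\,dx=-\int_{\mathbb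 H^n}M_2\left(\int_{\mathbb H^n}|\nabla_{\mathbb H}v|^2dx,\int_{\mathbb H^n}|\Delta_{\mathbb H}v|^2dx\right)v\,\Delta_{\mathbb H}\psi\,dx$$ for all test functions $0\le\varphi,\psi\in C_0^2(\mathbb H^n)$ (compactly supported $C^2$ functions). *)

theory Defs
  imports "HOL-Analysis.Analysis"
begin

type_synonym 'n heisenberg = "(real^'n) \<times> (real^'n) \<times> real"

definition partial :: "'a \<Rightarrow> ('a::euclidean_space \<Rightarrow> real) \<Rightarrow> 'a \<Rightarrow> real" where
  "partial b f x = frechet_derivative f (at x) b"

text \<open>
  Total differentiability at every stage is implied by continuity of the partial derivatives of
  the next order, so this is the usual class \<open>C\<^sup>k\<close>; it ensures that every
  \<^const>\<open>frechet_derivative\<close> involved is meaningful.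
\<close>

fun C_k :: "nat \<Rightarrow> ('a::euclidean_space \<Rightarrow> real) \<Rightarrow> bool" where
  "C_k 0 f \<longleftrightarrow> continuous_on UNIV f"
| "C_k (Suc k) f \<longleftrightarrow> f differentiable_on UNIV \<and> (\<forall>b\<in>Basis. C_k k (partial b f))"

definition compactly_supported :: "('a::euclidean_space \<Rightarrow> real) \<Rightarrow> bool" where
  "compactly_supported f \<longleftrightarrow> compact (closure {x. f x \<noteq> 0})"

definition C2_0 :: "('a::euclidean_space \<Rightarrow> real) set" where
  "C2_0 = {f. C_k 2 f \<and> compactly_supported f}"

definition Cinf_0 :: "('a::euclidean_space \<Rightarrow> real) set" where
  "Cinf_0 = {f. (\<forall>k. C_k k f) \<and> compactly_supported f}"

definition X_field :: "'n::finite \<Rightarrow> ('n heisenberg \<Rightarrow> real) \<Rightarrow> 'n heisenberg \<Rightarrow> real" where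
  "X_field i f x = (case x of (\<xi>, \<eta>, \<tau>) \<Rightarrow>
     partial (axis i 1, 0, 0) f x + 2 * \<eta> $ i * partial (0, 0, 1) f x)"

definition Y_field :: "'n::finite \<Rightarrow> ('n heisenberg \<Rightarrow> real) \<Rightarrow> 'n heisenberg \<Rightarrow> real" where
  "Y_field i f x = (case x of (\<xi>, \<eta>, \<tau>) \<Rightarrow>
     partial (0, axis i 1, 0) f x - 2 * \<xi> $ i * partial (0, 0, 1) f x)"

definition kohn_laplacian :: "('n::finite heisenberg \<Rightarrow> real) \<Rightarrow> 'n heisenberg \<Rightarrow> real" where
  "kohn_laplacian f x = (\<Sum>i\<in>UNIV. X_field i (X_field i f) x + Y_field i (Y_field i f) x)"

text \<open>
  The coefficient of \<open>\<partial>\<^sub>\<tau>\<close> in \<open>X\<^sub>i\<close> and \<open>Y\<^sub>i\<close> does not depend on the variables being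
  differentiated, so the formal adjoints with respect to Lebesgue measure are
  \<open>-X\<^sub>i\<close> and \<open>-Y\<^sub>i\<close>, and \<open>\<Delta>\<^sub>H\<close> is formally self-adjoint.
\<close>

definition Lp :: "real \<Rightarrow> ('a::euclidean_space \<Rightarrow> real) set" where
  "Lp p = {f. f \<in> borel_measurable lebesgue \<and> integrable lebesgue (\<lambda>x. \<bar>f x\<bar> powr p)}"

definition locally_integrable :: "('a::euclidean_space \<Rightarrow> real) \<Rightarrow> bool" where
  "locally_integrable f \<longleftrightarrow> (\<forall>K. compact K \<longrightarrow> set_integrable lebesgue K f)"

definition has_weak_gradient ::
  "('n::finite heisenberg \<Rightarrow> real) \<Rightarrow> ('n heisenberg \<Rightarrow> (real^'n) \<times> (real^'n)) \<Rightarrow> bool" where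
  "has_weak_gradient u G \<longleftrightarrow> (\<forall>i.
     locally_integrable (\<lambda>x. fst (G x) $ i) \<and> locally_integrable (\<lambda>x. snd (G x) $ i) \<and>
     (\<forall>\<phi>\<in>Cinf_0.
        (LINT x|lebesgue. u x * X_field i \<phi> x) = - (LINT x|lebesgue. fst (G x) $ i * \<phi> x) \<and>
        (LINT x|lebesgue. u x * Y_field i \<phi> x) = - (LINT x|lebesgue. snd (G x) $ i * \<phi> x)))"

definition has_weak_laplacian ::
  "('n::finite heisenberg \<Rightarrow> real) \<Rightarrow> ('n heisenberg \<Rightarrow> real) \<Rightarrow> bool" where
  "has_weak_laplacian u g \<longleftrightarrow> locally_integrable g \<and>
     (\<forall>\<phi>\<in>Cinf_0. (LINT x|lebesgue. u x * kohn_laplacian \<phi> x) = (LINT x|lebesgue. g x * \<phi> x))"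

text \<open>
  Weak derivatives are unique up to null sets, so the choice of a representative does not
  affect integrals. The choice is meaningful only where such a derivative exists, as on \<open>S22\<close>.
\<close>

definition weak_gradient ::
  "('n::finite heisenberg \<Rightarrow> real) \<Rightarrow> 'n heisenberg \<Rightarrow> (real^'n) \<times> (real^'n)" where
  "weak_gradient u = (SOME G. has_weak_gradient u G)"

definition weak_laplacian ::
  "('n::finite heisenberg \<Rightarrow> real) \<Rightarrow> 'n heisenberg \<Rightarrow> real" where
  "weak_laplacian u = (SOME g. has_weak_laplacian u g)"

text \<open>
  The norm on \<open>(real^'n) \<times> (real^'n)\<close> is the Euclidean norm of the \<open>2n\<close> components.
\<close>

definition S22 :: "('n::finite heisenberg \<Rightarrow> real) set" where
  "S22 = {u. u \<in> Lp 2 \<and>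
     (\<exists>G. has_weak_gradient u G) \<and> (\<lambda>x. norm (weak_gradient u x)) \<in> Lp 2 \<and>
     (\<exists>g. has_weak_laplacian u g) \<and> weak_laplacian u \<in> Lp 2}"

definition gradient_energy :: "('n::finite heisenberg \<Rightarrow> real) \<Rightarrow> real" where
  "gradient_energy u = (LINT x|lebesgue. (norm (weak_gradient u x))\<^sup>2)"

definition laplacian_energy :: "('n::finite heisenberg \<Rightarrow> real) \<Rightarrow> real" where
  "laplacian_energy u = (LINT x|lebesgue. \<bar>weak_laplacian u x\<bar>\<^sup>2)"

definition weak_solution ::
  "(real \<Rightarrow> real \<Rightarrow> real) \<Rightarrow> (real \<Rightarrow> real \<Rightarrow> real) \<Rightarrow> real \<Rightarrow> real \<Rightarrow>
   ('n::finite heisenberg \<Rightarrow> real) \<Rightarrow> ('n heisenberg \<Rightarrow> real) \<Rightarrow> bool" where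
  "weak_solution M1 M2 p q u v \<longleftrightarrow>
     u \<in> S22 \<inter> Lp p \<and> v \<in> S22 \<inter> Lp q \<and>
     (\<forall>\<phi>\<in>C2_0. (\<forall>x. 0 \<le> \<phi> x) \<longrightarrow>
        (LINT x|lebesgue. \<bar>v x\<bar> powr q * \<phi> x) =
        - (LINT x|lebesgue. M1 (gradient_energy u) (laplacian_energy u)
             * u x * kohn_laplacian \<phi> x)) \<and>
     (\<forall>\<psi>\<in>C2_0. (\<forall>x. 0 \<le> \<psi> x) \<longrightarrow>
        (LINT x|lebesgue. \<bar>u x\<bar> powr p * \<psi> x) =
        - (LINT x|lebesgue. M2 (gradient_energy v) (laplacian_energy v)
             * v x * kohn_laplacian \<psi> x))"

end

theory Submission
  imports Defs
begin

text \<open>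
  Test the system with \<open>\<phi>\<^sub>R = (1 - N / R\<^sup>4)\<^sub>+\<^sup>k\<close>, where \<open>N = (\<bar>\<xi>\<bar>\<^sup>2 + \<bar>\<eta>\<bar>\<^sup>2)\<^sup>2 + \<tau>\<^sup>2\<close>
  is the fourth power of the Koranyi gauge. Its Laplacian is bounded by \<open>K R\<^sup>-\<^sup>2 w\<^sub>R\<close> with
  \<open>0 \<le> w\<^sub>R \<le> \<phi>\<^sub>R powr (1/p)\<close> for large \<open>k\<close>, and \<open>w\<^sub>R\<close> tends to \<open>0\<close> pointwise, because the
  Laplacian of \<open>N\<close> and the horizontal gradient of \<open>N\<close> vanish at the origin. As the support of
  \<open>\<phi>\<^sub>R\<close> has volume of order \<open>R powr Q\<close>, Hoelder's inequality gives, for \<open>A = \<integral>\<bar>v\<bar>\<^sup>q\<phi>\<^sub>R\<close>,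
  \<open>B = \<integral>\<bar>u\<bar>\<^sup>p\<phi>\<^sub>R\<close> and \<open>E = \<integral>\<bar>v\<bar>\<^sup>qw\<^sub>R\<^sup>q\<close>,
  \<open>A \<le> c R powr (Q(1 - 1/p) - 2) B powr (1/p)\<close> and \<open>B \<le> c R powr (Q(1 - 1/q) - 2) E powr (1/q)\<close>.
  Combined, the power of \<open>R\<close> is \<open>Q(1 - 1/(pq)) - 2(1 + 1/p) \<le> 0\<close>, and \<open>E\<close> tends to \<open>0\<close> by dominated
  convergence, also in the critical case. Hence \<open>\<integral>\<bar>v\<bar>\<^sup>q = 0\<close>. The condition with \<open>1 + 1/q\<close> follows
  by exchanging \<open>u\<close> and \<open>v\<close>.
\<close>

subsection \<open>Truncated powers and the vector fields\<close>

text \<open>For \<open>k = 0\<close> this is the constant 1, also for negative \<open>s\<close>.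
  Hence the condition \<open>k \<ge> 1\<close> wherever the power has to vanish for
  \<open>s \<le> 0\<close> or be the derivative of the next one.\<close>

definition pos_pow :: "nat \<Rightarrow> real \<Rightarrow> real" where
  "pos_pow k s = max 0 s ^ k"

lemma has_real_derivative_pos_pow:
  assumes "k \<ge> 1"
  shows "(pos_pow (Suc k) has_real_derivative real (Suc k) * pos_pow k s) (at s)"
proof -
  consider "s > 0" | "s < 0" | "s = 0" by linarith
  then show ?thesis
  proof cases
    case 1
    have "((\<lambda>t. t ^ Suc k) has_real_derivative real (Suc k) * pos_pow k s) (at s)"
      using 1 DERIV_pow[of "Suc k" s] by (simp add: pos_pow_def)
    then show ?thesis
      by (rule has_field_derivative_transform_within_open[where S = "{0<..}"])
        (use 1 in \<open>auto simp: pos_pow_def\<close>)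
  next
    case 2
    have "pos_pow k s = 0"
      using 2 assms by (simp add: pos_pow_def)
    then have "((\<lambda>t. 0) has_real_derivative real (Suc k) * pos_pow k s) (at s)"
      by simp
    then show ?thesis
      by (rule has_field_derivative_transform_within_open[where S = "{..<0}"])
        (use 2 in \<open>auto simp: pos_pow_def\<close>)
  next
    case 3
    \<comment> \<open>At 0 the one-sided derivatives are joined by Caratheodory's criterion: the
      slope function is \<open>pos_pow k\<close> itself, continuous with value 0 at 0, which is also
      the claimed derivative.\<close>
    have "pos_pow (Suc k) z - pos_pow (Suc k) 0 = pos_pow k z * (z - 0)" for z
      using assms by (cases "z \<le> 0") (auto simp: pos_pow_def max_def)
    moreover have "isCont (pos_pow k) 0"
      unfolding pos_pow_def by (intro continuous_intros)
    moreover have "pos_pow k 0 = real (Suc k) * pos_pow k 0"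
      using assms by (simp add: pos_pow_def)
    ultimately show ?thesis
      unfolding 3 CARAT_DERIV by blast
  qed
qed

lemma continuous_on_pos_pow [continuous_intros]:
  "continuous_on S f \<Longrightarrow> continuous_on S (\<lambda>x. pos_pow k (f x))"
  unfolding pos_pow_def by (intro continuous_intros)

lemma pos_pow_nonneg [simp]: "0 \<le> pos_pow k s"
  by (simp add: pos_pow_def)

lemma pos_pow_has_derivative [derivative_intros]:
  assumes "k \<ge> 1" "(g has_derivative g') (at x)"
  shows "((\<lambda>x. pos_pow (Suc k) (g x)) has_derivative
           (\<lambda>h. g' h * (real (Suc k) * pos_pow k (g x)))) (at x)"
  using DERIV_compose_FDERIV[OF has_real_derivative_pos_pow[OF assms(1)] assms(2)] .

lemma partial_eq: "(f has_derivative D) (at x) \<Longrightarrow> partial b f x = D b"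
  unfolding partial_def by (metis frechet_derivative_at)

text \<open>Derivatives are unique, so explicit first and second derivatives identify the iterated
  \<open>partial\<close> of the recursive definition.\<close>

lemma C_k_2I:
  assumes "\<And>x. (f has_derivative f' x) (at x)"
    and "\<And>b x. b \<in> Basis \<Longrightarrow> ((\<lambda>x. f' x b) has_derivative f'' b x) (at x)"
    and "\<And>b c. b \<in> Basis \<Longrightarrow> c \<in> Basis \<Longrightarrow> continuous_on UNIV (\<lambda>x. f'' b x c)"
  shows "C_k 2 f"
proof -
  have 1: "partial b f = (\<lambda>x. f' x b)" for b
    using partial_eq[OF assms(1)] by blast
  have 2: "partial c (\<lambda>x. f' x b) = (\<lambda>x. f'' b x c)" if "b \<in> Basis" for b c
    using partial_eq[OF assms(2)[OF that]] by blast
  show ?thesis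
    unfolding numeral_2_eq_2 C_k.simps differentiable_on_def
    using assms by (auto simp: 1 2 differentiable_def)
qed

text \<open>By linearity of \<open>D\<close> the field is a single directional derivative, along its
  coefficient vector at \<open>x\<close>. One total derivative then yields all the fields without
  separate partials.\<close>

lemma X_field_eq:
  assumes "(f has_derivative D) (at x)"
  shows "X_field i f x = D (axis i 1, 0, 2 * fst (snd x) $ i)"
proof -
  interpret linear D using assms has_derivative_linear by blast
  have "(axis i 1, 0, 2 * fst (snd x) $ i)
          = (axis i 1, 0, 0) + (2 * fst (snd x) $ i) *\<^sub>R (0 :: real^'a, 0 :: real^'a, 1 :: real)"
    by simp
  then have "D (axis i 1, 0, 2 * fst (snd x) $ i)
      = D (axis i 1, 0, 0) + (2 * fst (snd x) $ i) * D (0, 0, 1)"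
    by (metis add scaleR real_scaleR_def)
  then show ?thesis
    by (simp add: X_field_def partial_eq[OF assms] split: prod.splits)
qed

lemma Y_field_eq:
  assumes "(f has_derivative D) (at x)"
  shows "Y_field i f x = D (0, axis i 1, - 2 * fst x $ i)"
proof -
  interpret linear D using assms has_derivative_linear by blast
  have "(0, axis i 1, - 2 * fst x $ i)
          = (0, axis i 1, 0) + (- 2 * fst x $ i) *\<^sub>R (0 :: real^'a, 0 :: real^'a, 1 :: real)"
    by simp
  then have "D (0, axis i 1, - 2 * fst x $ i)
      = D (0, axis i 1, 0) + (- 2 * fst x $ i) * D (0, 0, 1)"
    by (metis add scaleR real_scaleR_def)
  then show ?thesis
    by (simp add: Y_field_def partial_eq[OF assms] split: prod.splits)
qed

subsection \<open>Cutoff functions and their Laplacian\<close>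

definition horiz :: "'n::finite heisenberg \<Rightarrow> 'n heisenberg \<Rightarrow> real" where
  "horiz x y = fst x \<bullet> fst y + fst (snd x) \<bullet> fst (snd y)"

text \<open>The fourth power is a polynomial, hence smooth at the origin, and it scales by the
  fourth power of the dilation factor, which explains \<open>R ^ 4\<close> in the cutoff. The
  coefficient 1 of the squared vertical variable matches the 2 in the fields: it makes the cross
  terms in the squared horizontal gradient cancel.\<close>

definition gauge4 :: "'n::finite heisenberg \<Rightarrow> real" where
  "gauge4 x = (horiz x x)\<^sup>2 + (snd (snd x))\<^sup>2"

definition cutoff :: "nat \<Rightarrow> real \<Rightarrow> 'n::finite heisenberg \<Rightarrow> real" where
  "cutoff k R x = pos_pow k (1 - gauge4 x / R ^ 4)"

definition dgauge4 :: "'n::finite heisenberg \<Rightarrow> 'n heisenberg \<Rightarrow> real" where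
  "dgauge4 x h = 4 * horiz x x * horiz x h + 2 * snd (snd x) * snd (snd h)"

lemma horiz_has_derivative [derivative_intros]:
  assumes "(f has_derivative f') (at x within S)" "(g has_derivative g') (at x within S)"
  shows "((\<lambda>x. horiz (f x) (g x)) has_derivative (\<lambda>h. horiz (f x) (g' h) + horiz (f' h) (g x)))
           (at x within S)"
  unfolding horiz_def
  by (rule derivative_eq_intros assms refl)+ (simp add: algebra_simps)

lemma horiz_commute: "horiz x y = horiz y x"
  by (simp add: horiz_def inner_commute)

lemma continuous_on_horiz [continuous_intros]:
  "continuous_on S f \<Longrightarrow> continuous_on S g \<Longrightarrow> continuous_on S (\<lambda>x. horiz (f x) (g x))"
  unfolding horiz_def by (intro continuous_intros)

lemma gauge4_has_derivative: "(gauge4 has_derivative dgauge4 x) (at x)"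
  unfolding gauge4_def[abs_def] dgauge4_def[abs_def]
  by (rule derivative_eq_intros refl)+
    (auto simp: fun_eq_iff horiz_commute algebra_simps)

lemma gauge4_quot_has_derivative:
  "((\<lambda>x. 1 - gauge4 x / R ^ 4) has_derivative (\<lambda>h. - dgauge4 x h / R ^ 4)) (at x)"
proof -
  have "((\<lambda>x. 1 - gauge4 x * (1 / R ^ 4)) has_derivative
          (\<lambda>h. 0 - dgauge4 x h * (1 / R ^ 4))) (at x)"
    by (intro has_derivative_diff has_derivative_const has_derivative_mult_left
        gauge4_has_derivative)
  then show ?thesis by simp
qed

lemma cutoff_has_derivative:
  assumes "k \<ge> 1"
  shows "(cutoff (Suc k) R has_derivative
           (\<lambda>h. - real (Suc k) / R ^ 4 * pos_pow k (1 - gauge4 x / R ^ 4) * dgauge4 x h)) (at x)"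
  unfolding cutoff_def[abs_def]
  by (rule has_derivative_eq_rhs[OF pos_pow_has_derivative[OF assms gauge4_quot_has_derivative]])
    (simp add: fun_eq_iff algebra_simps add_divide_distrib diff_divide_distrib)

text \<open>Every first derivative of the cutoff has this shape. The factor \<open>g\<close> is a
  directional derivative of \<open>gauge4\<close> in a fixed direction for the C2 property, and
  along a horizontal field for the Laplacian.\<close>

lemma dcutoff_has_derivative:
  assumes "m \<ge> 1" "(g has_derivative g') (at x)"
  shows "((\<lambda>x. c * pos_pow (Suc m) (1 - gauge4 x / R ^ 4) * g x) has_derivative
    (\<lambda>h. c * (pos_pow (Suc m) (1 - gauge4 x / R ^ 4) * g' h
      - real (Suc m) / R ^ 4 * pos_pow m (1 - gauge4 x / R ^ 4) * dgauge4 x h * g x))) (at x)"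
proof -
  note D = has_derivative_mult[OF has_derivative_mult_right[OF
      pos_pow_has_derivative[OF assms(1) gauge4_quot_has_derivative], of c] assms(2)]
  show ?thesis
    by (rule has_derivative_eq_rhs[OF D])
      (simp add: fun_eq_iff algebra_simps add_divide_distrib diff_divide_distrib)
qed

lemma dgauge4_has_derivative:
  "((\<lambda>x. dgauge4 x b) has_derivative
     (\<lambda>h. 8 * horiz x h * horiz x b + 4 * horiz x x * horiz h b + 2 * snd (snd h) * snd (snd b)))
     (at x)"
  unfolding dgauge4_def[abs_def]
  by (rule derivative_eq_intros refl)+
    (auto simp: fun_eq_iff horiz_commute horiz_def algebra_simps)

text \<open>Two differentiations lower the exponent from \<open>m + 2\<close> to \<open>m\<close>,
  and the second one applies the derivative rule to \<open>pos_pow (Suc m)\<close>, which requires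
  \<open>m \<ge> 1\<close>.\<close>

lemma C_k_2_cutoff:
  assumes "m \<ge> 1"
  shows "C_k 2 (cutoff (Suc (Suc m)) R)"
proof (rule C_k_2I)
  show "(cutoff (Suc (Suc m)) R has_derivative
           (\<lambda>h. - real (Suc (Suc m)) / R ^ 4 * pos_pow (Suc m) (1 - gauge4 x / R ^ 4) * dgauge4 x h))
           (at x)" for x :: "'a heisenberg"
    by (rule cutoff_has_derivative) simp
  show "((\<lambda>x. - real (Suc (Suc m)) / R ^ 4 * pos_pow (Suc m) (1 - gauge4 x / R ^ 4) * dgauge4 x b)
     has_derivative
    (\<lambda>h. - real (Suc (Suc m)) / R ^ 4 * (pos_pow (Suc m) (1 - gauge4 x / R ^ 4) *
        (8 * horiz x h * horiz x b + 4 * horiz x x * horiz h b + 2 * snd (snd h) * snd (snd b))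
      - real (Suc m) / R ^ 4 * pos_pow m (1 - gauge4 x / R ^ 4) * dgauge4 x h * dgauge4 x b))) (at x)"
      for b x :: "'a heisenberg"
    by (rule dcutoff_has_derivative[OF assms dgauge4_has_derivative])
qed (unfold gauge4_def dgauge4_def divide_inverse, intro continuous_intros)

text \<open>The last factor is the derivative of \<open>gauge4\<close> along the field; likewise for
  \<open>Y_field\<close> below.\<close>

lemma X_field_cutoff:
  assumes "k \<ge> 1"
  shows "X_field i (cutoff (Suc k) R) x = - real (Suc k) / R ^ 4 * pos_pow k (1 - gauge4 x / R ^ 4)
           * (4 * horiz x x * fst x $ i + 4 * fst (snd x) $ i * snd (snd x))"
  unfolding X_field_eq[OF cutoff_has_derivative[OF assms]]
  by (simp add: dgauge4_def horiz_def inner_axis algebra_simps)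

lemma Y_field_cutoff:
  assumes "k \<ge> 1"
  shows "Y_field i (cutoff (Suc k) R) x = - real (Suc k) / R ^ 4 * pos_pow k (1 - gauge4 x / R ^ 4)
           * (4 * horiz x x * fst (snd x) $ i - 4 * fst x $ i * snd (snd x))"
  unfolding Y_field_eq[OF cutoff_has_derivative[OF assms]]
  by (simp add: dgauge4_def horiz_def inner_axis algebra_simps)

lemma horiz_self: "horiz x x = (\<Sum>i\<in>UNIV. (fst x $ i)\<^sup>2 + (fst (snd x) $ i)\<^sup>2)"
  by (simp add: horiz_def inner_vec_def power2_eq_square sum.distrib)

lemma coord_has_derivative:
  fixes x :: "'n::finite heisenberg"
  shows "((\<lambda>x. fst x $ i) has_derivative (\<lambda>h. fst h $ i)) (at x)"
    "((\<lambda>x. fst (snd x) $ i) has_derivative (\<lambda>h. fst (snd h) $ i)) (at x)"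
    "((\<lambda>x. snd (snd x)) has_derivative (\<lambda>h. snd (snd h))) (at x)"
  by (intro bounded_linear_imp_has_derivative bounded_linear_compose[OF bounded_linear_vec_nth]
      bounded_linear_compose[OF bounded_linear_fst] bounded_linear_compose[OF bounded_linear_snd]
      bounded_linear_fst bounded_linear_snd)+

lemma horiz_self_has_derivative:
  "((\<lambda>x. horiz x x) has_derivative (\<lambda>h. 2 * horiz x h)) (at x)"
  by (rule has_derivative_eq_rhs[OF horiz_has_derivative[OF has_derivative_ident has_derivative_ident]])
    (simp add: fun_eq_iff horiz_commute)

text \<open>Chain rule: the factor next to \<open>pos_pow (Suc m)\<close> is the second derivative
  of \<open>gauge4\<close> along the field, and the square next to \<open>pos_pow m\<close> is that
  of its first derivative.\<close>

lemma X_field_X_field_cutoff: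
  assumes "m \<ge> 1"
  shows "X_field i (X_field i (cutoff (Suc (Suc m)) R)) x = - real (Suc (Suc m)) / R ^ 4 *
     (pos_pow (Suc m) (1 - gauge4 x / R ^ 4) *
        (8 * (fst x $ i)\<^sup>2 + 8 * (fst (snd x) $ i)\<^sup>2 + 4 * horiz x x)
      - real (Suc m) / R ^ 4 * pos_pow m (1 - gauge4 x / R ^ 4)
         * (4 * horiz x x * fst x $ i + 4 * fst (snd x) $ i * snd (snd x))\<^sup>2)"
proof -
  have "((\<lambda>x. 4 * horiz x x * fst x $ i + 4 * fst (snd x) $ i * snd (snd x)) has_derivative
     (\<lambda>h. 8 * horiz x h * fst x $ i + 4 * horiz x x * fst h $ i
        + 4 * fst (snd h) $ i * snd (snd x) + 4 * fst (snd x) $ i * snd (snd h))) (at x)"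
    by (rule has_derivative_eq_rhs, (rule has_derivative_add has_derivative_diff has_derivative_mult
          has_derivative_const horiz_self_has_derivative coord_has_derivative)+)
      (simp add: fun_eq_iff algebra_simps)
  note D = dcutoff_has_derivative[OF assms this]
  have e: "X_field i (cutoff (Suc (Suc m)) R) = (\<lambda>x.
      - real (Suc (Suc m)) / R ^ 4 * pos_pow (Suc m) (1 - gauge4 x / R ^ 4)
           * (4 * horiz x x * fst x $ i + 4 * fst (snd x) $ i * snd (snd x)))"
    by (rule ext, rule X_field_cutoff) simp
  have "horiz x (axis i 1, 0, 2 * fst (snd x) $ i) = fst x $ i" "dgauge4 x (axis i 1, 0, 2 * fst (snd x) $ i) = 4 * horiz x x * fst x $ i + 4 * fst (snd x) $ i * snd (snd x)"
    by (simp_all add: dgauge4_def horiz_def inner_axis)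
  then show ?thesis
    unfolding e X_field_eq[OF D] by (simp add: power2_eq_square ac_simps)
qed

lemma Y_field_Y_field_cutoff:
  assumes "m \<ge> 1"
  shows "Y_field i (Y_field i (cutoff (Suc (Suc m)) R)) x = - real (Suc (Suc m)) / R ^ 4 *
     (pos_pow (Suc m) (1 - gauge4 x / R ^ 4) *
        (8 * (fst x $ i)\<^sup>2 + 8 * (fst (snd x) $ i)\<^sup>2 + 4 * horiz x x)
      - real (Suc m) / R ^ 4 * pos_pow m (1 - gauge4 x / R ^ 4)
         * (4 * horiz x x * fst (snd x) $ i - 4 * fst x $ i * snd (snd x))\<^sup>2)"
proof -
  have "((\<lambda>x. 4 * horiz x x * fst (snd x) $ i - 4 * fst x $ i * snd (snd x)) has_derivative
     (\<lambda>h. 8 * horiz x h * fst (snd x) $ i + 4 * horiz x x * fst (snd h) $ i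
        - 4 * fst h $ i * snd (snd x) - 4 * fst x $ i * snd (snd h))) (at x)"
    by (rule has_derivative_eq_rhs, (rule has_derivative_add has_derivative_diff has_derivative_mult
          has_derivative_const horiz_self_has_derivative coord_has_derivative)+)
      (simp add: fun_eq_iff algebra_simps)
  note D = dcutoff_has_derivative[OF assms this]
  have e: "Y_field i (cutoff (Suc (Suc m)) R) = (\<lambda>x.
      - real (Suc (Suc m)) / R ^ 4 * pos_pow (Suc m) (1 - gauge4 x / R ^ 4)
           * (4 * horiz x x * fst (snd x) $ i - 4 * fst x $ i * snd (snd x)))"
    by (rule ext, rule Y_field_cutoff) simp
  have "horiz x (0, axis i 1, - 2 * fst x $ i) = fst (snd x) $ i" "dgauge4 x (0, axis i 1, - 2 * fst x $ i) = 4 * horiz x x * fst (snd x) $ i - 4 * fst x $ i * snd (snd x)"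
    by (simp_all add: dgauge4_def horiz_def inner_axis)
  then show ?thesis
    unfolding e Y_field_eq[OF D] by (simp add: power2_eq_square ac_simps)
qed

text \<open>For F(N) with N = \<open>gauge4\<close>, the Laplacian is F'(N) times that of N plus
  F''(N) times the squared horizontal gradient of N. With S = \<open>horiz x x\<close> these are (16
  + 8n) S and 16 S N. The common factor S is kept in front, since it is what makes the weights of
  the main argument vanish in the limit.\<close>

lemma kohn_laplacian_cutoff:
  fixes x :: "'n::finite heisenberg"
  assumes "m \<ge> 1"
  shows "kohn_laplacian (cutoff (Suc (Suc m)) R) x =
      real (Suc (Suc m)) / R ^ 4 * horiz x x *
       (16 * real (Suc m) * pos_pow m (1 - gauge4 x / R ^ 4) * (gauge4 x / R ^ 4)
         - (16 + 8 * real CARD('n)) * pos_pow (Suc m) (1 - gauge4 x / R ^ 4))"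
proof -
  define S t where "S = horiz x x" and "t = snd (snd x)"
  define P P' where "P = pos_pow (Suc m) (1 - gauge4 x / R ^ 4)"
    and "P' = pos_pow m (1 - gauge4 x / R ^ 4)"
  define r where "r i = (fst x $ i)\<^sup>2 + (fst (snd x) $ i)\<^sup>2" for i
  \<comment> \<open>The mixed terms of the two squares have opposite signs and cancel, leaving 16
    \<open>gauge4\<close> times the i-th summand of \<open>horiz x x\<close>.\<close>
  have alg: "- c / R ^ 4 * (P * (8 * a\<^sup>2 + 8 * b\<^sup>2 + 4 * S) - d * P' * (4 * S * a + 4 * b * t)\<^sup>2)
      + - c / R ^ 4 * (P * (8 * a\<^sup>2 + 8 * b\<^sup>2 + 4 * S) - d * P' * (4 * S * b - 4 * a * t)\<^sup>2)
      = - c / R ^ 4 * (P * (16 * (a\<^sup>2 + b\<^sup>2) + 8 * S)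
          - d * P' * (16 * (S\<^sup>2 + t\<^sup>2) * (a\<^sup>2 + b\<^sup>2)))" for a b c d :: real
    by (simp add: power2_eq_square algebra_simps)
  have "kohn_laplacian (cutoff (Suc (Suc m)) R) x = (\<Sum>i\<in>UNIV. - real (Suc (Suc m)) / R ^ 4 *
     (P * (16 * r i + 8 * S) - real (Suc m) / R ^ 4 * P' * (16 * gauge4 x * r i)))"
    unfolding kohn_laplacian_def X_field_X_field_cutoff[OF assms] Y_field_Y_field_cutoff[OF assms]
    by (intro sum.cong refl, fold P_def P'_def S_def t_def, subst alg)
      (simp add: S_def t_def r_def gauge4_def)
  also have "\<dots> = - real (Suc (Suc m)) / R ^ 4 *
     (P * (16 * (\<Sum>i\<in>UNIV. r i) + 8 * real CARD('n) * S)
        - real (Suc m) / R ^ 4 * P' * (16 * gauge4 x * (\<Sum>i\<in>UNIV. r i)))"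
  proof -
    have "(\<Sum>i\<in>UNIV. c * (P * (16 * r i + 8 * S) - d * (g * r i)))
        = c * (P * (16 * (\<Sum>i\<in>UNIV. r i) + 8 * real CARD('n) * S) - d * (g * (\<Sum>i\<in>UNIV. r i)))"
      for c d g :: real
      by (simp add: sum_distrib_left[symmetric] sum_subtractf sum.distrib)
    then show ?thesis .
  qed
  also have "(\<Sum>i\<in>UNIV. r i) = S"
    by (simp add: r_def S_def horiz_self)
  also have "- c / e * (P * (16 * S + 8 * real CARD('n) * S) - d / e * P' * (16 * g * S))
      = c / e * S * (16 * d * P' * (g / e) - (16 + 8 * real CARD('n)) * P)" for c d e g :: real
    by (simp add: algebra_simps)
  finally show ?thesis
    unfolding S_def P_def P'_def .
qed

lemma gauge4_nonneg: "0 \<le> gauge4 x"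
  by (simp add: gauge4_def)

lemma horiz_self_nonneg: "0 \<le> horiz x x"
  by (simp add: horiz_def)

text \<open>On the support \<open>s = gauge4 x / R ^ 4\<close> lies in [0, 1], so after extracting
  \<open>pos_pow m\<close> the bracket is bounded by a constant. Outside, both truncated powers
  vanish because \<open>m \<ge> 1\<close>.\<close>

lemma kohn_laplacian_cutoff_bound:
  fixes x :: "'n::finite heisenberg"
  assumes "m \<ge> 1" "R > 0"
  shows "\<bar>kohn_laplacian (cutoff (Suc (Suc m)) R) x\<bar> \<le>
      real (Suc (Suc m)) * (16 * real (Suc m) + 16 + 8 * real CARD('n)) *
       (horiz x x / R ^ 4) * pos_pow m (1 - gauge4 x / R ^ 4)"
proof (cases "gauge4 x < R ^ 4")
  case True
  define s where "s = gauge4 x / R ^ 4"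
  have s: "0 \<le> s" "s \<le> 1"
    using True gauge4_nonneg[of x] \<open>R > 0\<close> by (auto simp: s_def)
  have P: "pos_pow (Suc m) (1 - s) = (1 - s) * pos_pow m (1 - s)"
    using s by (simp add: pos_pow_def)
  define c where "c = (16 + 8 * real CARD('n))"
  have "\<bar>16 * real (Suc m) * s - c * (1 - s)\<bar> \<le> 16 * real (Suc m) + c"
  proof -
    have "0 \<le> 16 * real (Suc m) * s" "16 * real (Suc m) * s \<le> 16 * real (Suc m)"
      "0 \<le> c * (1 - s)" "c * (1 - s) \<le> c"
      using s by (auto simp: c_def intro!: mult_left_le)
    then show ?thesis by linarith
  qed
  then have "\<bar>(16 * real (Suc m) * s - c * (1 - s)) * pos_pow m (1 - s)\<bar>
      \<le> (16 * real (Suc m) + c) * pos_pow m (1 - s)"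
    by (auto simp: abs_mult intro!: mult_right_mono)
  moreover have "0 \<le> real (Suc (Suc m)) / R ^ 4 * horiz x x"
    using \<open>R > 0\<close> by (simp add: horiz_self_nonneg)
  ultimately have "\<bar>real (Suc (Suc m)) / R ^ 4 * horiz x x *
      ((16 * real (Suc m) * s - c * (1 - s)) * pos_pow m (1 - s))\<bar> \<le>
      real (Suc (Suc m)) / R ^ 4 * horiz x x * ((16 * real (Suc m) + c) * pos_pow m (1 - s))"
    using mult_left_mono abs_mult abs_of_nonneg by metis
  then show ?thesis
    unfolding kohn_laplacian_cutoff[OF assms(1)] s_def[symmetric] P c_def
    by (simp only: mult.assoc mult.commute mult.left_commute times_divide_eq_left
        times_divide_eq_right left_diff_distrib right_diff_distrib add.assoc)
next
  case False
  then have "1 - gauge4 x / R ^ 4 \<le> 0" using \<open>R > 0\<close> by simp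
  then have "pos_pow m (1 - gauge4 x / R ^ 4) = 0" "pos_pow (Suc m) (1 - gauge4 x / R ^ 4) = 0"
    using assms by (auto simp: pos_pow_def)
  then show ?thesis
    by (simp add: kohn_laplacian_cutoff[OF assms(1)])
qed

subsection \<open>Hoelder's inequality\<close>

lemma Holder_indicator:
  fixes h :: "'a \<Rightarrow> real"
  assumes "p > 1" and h: "h \<in> borel_measurable M" "\<And>x. 0 \<le> h x"
    and int: "integrable M (\<lambda>x. h x powr p)" and B: "B \<in> fmeasurable M"
  shows "integrable M (\<lambda>x. h x * indicator B x)"
    and "(LINT x|M. h x * indicator B x) \<le>
      (LINT x|M. h x powr p) powr (1 / p) * measure M B powr (1 - 1 / p)"
proof -
  define q where "q = 1 / (1 - 1 / p)"
  have q: "q > 1" "1 / p + 1 / q = 1"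
    using \<open>p > 1\<close> by (auto simp: q_def field_simps)
  have intB: "integrable M (indicator B :: 'a \<Rightarrow> real)"
    using B by (simp add: fmeasurable_def)
  have meas: "(\<lambda>x. h x * indicator B x) \<in> borel_measurable M"
    using h intB by auto
  \<comment> \<open>Young's inequality with free scales \<open>s\<close> and \<open>t\<close>. The
    scales 1 and 1 already give integrability; the norms of the two factors give the sharp
    bound.\<close>
  have young: "h x * indicator B x \<le> s * t * (h x powr p / s powr p / p + indicator B x / t powr q / q)"
    if "s > 0" "t > 0" for s t x
  proof -
    have "(h x / s) * (indicator B x / t) \<le> (h x / s) powr p / p + (indicator B x / t) powr q / q"
      using h(2) that q \<open>p > 1\<close> by (intro Youngs_inequality) auto
    also have "\<dots> = h x powr p / s powr p / p + indicator B x / t powr q / q"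
      using h(2)[of x] that by (simp add: powr_divide indicator_def)
    finally show ?thesis
      using that by (simp add: field_simps)
  qed
  have intY: "integrable M (\<lambda>x. s * t * (h x powr p / s powr p / p + indicator B x / t powr q / q))"
    for s t
    using int intB by simp
  show I: "integrable M (\<lambda>x. h x * indicator B x)"
    by (rule Bochner_Integration.integrable_bound[OF intY[of 1 1] meas])
      (use young[of 1 1] h(2) in \<open>auto simp: abs_mult intro!: order_trans[OF _ abs_ge_self]\<close>)
  define S T where "S = (LINT x|M. h x powr p)" and "T = measure M B"
  have ST: "S \<ge> 0" "T \<ge> 0" by (auto simp: S_def T_def intro: Bochner_Integration.integral_nonneg)
  show "(LINT x|M. h x * indicator B x) \<le> S powr (1 / p) * T powr (1 - 1 / p)"
  \<comment> \<open>The norms can serve as scales only if both are positive; otherwise the product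
    vanishes almost everywhere.\<close>
  proof (cases "S = 0 \<or> T = 0")
    case True
    have "AE x in M. h x * indicator B x = 0"
    proof (cases "S = 0")
      case True
      then have "AE x in M. h x powr p = 0"
        unfolding S_def using int by (subst (asm) integral_nonneg_eq_0_iff_AE) auto
      then show ?thesis by eventually_elim simp
    next
      case False
      with True have "measure M B = 0" by (simp add: T_def)
      then have "emeasure M B = 0"
        using emeasure_eq_ennreal_measure[of M B] fmeasurableD2[OF B] by simp
      then have "AE x in M. x \<notin> B"
        using fmeasurableD[OF B] by (intro AE_not_in null_setsI)
      then show ?thesis by eventually_elim simp
    qed
    then have "(LINT x|M. h x * indicator B x) = 0"
      by (rule integral_eq_zero_AE)
    then show ?thesis by simp
  next
    case False
    with ST have pos: "S > 0" "T > 0" by auto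
    define s t where "s = S powr (1 / p)" and "t = T powr (1 / q)"
    have st: "s > 0" "t > 0" "s powr p = S" "t powr q = T"
      using pos \<open>p > 1\<close> q by (auto simp: s_def t_def powr_powr)
    have "(LINT x|M. h x * indicator B x)
        \<le> (LINT x|M. s * t * (h x powr p / s powr p / p + indicator B x / t powr q / q))"
      by (intro integral_mono I intY young st)
    also have "\<dots> = s * t * (S / s powr p / p + T / t powr q / q)"
      using int intB B by (simp add: S_def T_def fmeasurable_def)
    also have "\<dots> = s * t"
      using pos q st by simp
    also have "1 / q = 1 - 1 / p \<Longrightarrow> \<dots> = S powr (1 / p) * T powr (1 - 1 / p)"
      by (simp only: s_def t_def)
    finally show ?thesis using q by simp
  qed
qed

subsection \<open>Supports and integral bounds\<close>

text \<open>A Euclidean box containing the gauge ball of radius \<open>R\<close>. Its half-sides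
  follow the dilations, so its volume is a constant times \<open>R\<close> to the homogeneous
  dimension and the volume of the ball itself need not be computed.\<close>

definition koranyi_box :: "real \<Rightarrow> 'n::finite heisenberg set" where
  "koranyi_box R = cbox (\<chi> i. - R, \<chi> i. - R, - R\<^sup>2) (\<chi> i. R, \<chi> i. R, R\<^sup>2)"

lemma measure_koranyi_box:
  assumes "R \<ge> 0"
  shows "measure lebesgue (koranyi_box R :: 'n::finite heisenberg set)
    = 2 ^ (2 * CARD('n) + 1) * R ^ (2 * CARD('n) + 2)"
proof -
  have "cbox (\<chi> i. - R) (\<chi> i. R) \<noteq> ({} :: (real^'n) set)"
    using assms by (simp add: interval_ne_empty_cart)
  then have "measure lborel (cbox (\<chi> i. - R) (\<chi> i. R) :: (real^'n) set) = (2 * R) ^ CARD('n)"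
    by (simp add: content_cbox_cart)
  then have "measure lebesgue (koranyi_box R :: 'n heisenberg set)
      = (2 * R) ^ CARD('n) * ((2 * R) ^ CARD('n) * (2 * R\<^sup>2))"
    by (simp add: koranyi_box_def content_Pair)
  also have "\<dots> = 2 ^ (2 * CARD('n) + 1) * R ^ (2 * CARD('n) + 2)"
    by (simp add: power_mult_distrib power_add mult_2[of "CARD('n)"] power2_eq_square)
  finally show ?thesis .
qed

lemma fmeasurable_koranyi_box: "koranyi_box R \<in> fmeasurable lebesgue"
  by (simp add: koranyi_box_def)

lemma horiz_le_of_gauge4_le:
  assumes "gauge4 x \<le> R ^ 4"
  shows "horiz x x \<le> R\<^sup>2"
proof -
  have "(horiz x x)\<^sup>2 \<le> (R\<^sup>2)\<^sup>2"
    using assms by (simp add: gauge4_def) (smt (verit) zero_le_power2)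
  then show ?thesis by (rule power2_le_imp_le) simp
qed

lemma mem_koranyi_box_of_gauge4_le:
  assumes "gauge4 x \<le> R ^ 4" "R \<ge> 0"
  shows "x \<in> koranyi_box R"
proof -
  obtain a b t where x: "x = (a, b, t)" by (cases x) auto
  have "t\<^sup>2 \<le> (R\<^sup>2)\<^sup>2"
    using assms(1) by (simp add: gauge4_def x) (smt (verit) zero_le_power2)
  then have t: "\<bar>t\<bar> \<le> R\<^sup>2" by (rule power2_le_iff_abs_le[THEN iffD1, rotated]) simp
  have "(a $ i)\<^sup>2 + (b $ i)\<^sup>2 \<le> R\<^sup>2" for i
  proof -
    have "(a $ i)\<^sup>2 + (b $ i)\<^sup>2 \<le> horiz x x"
      unfolding horiz_self x fst_conv snd_conv by (intro member_le_sum) auto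
    with horiz_le_of_gauge4_le[OF assms(1)] show ?thesis by linarith
  qed
  then have "(a $ i)\<^sup>2 \<le> R\<^sup>2" "(b $ i)\<^sup>2 \<le> R\<^sup>2" for i
    by (smt (verit) zero_le_power2)+
  then have "\<bar>a $ i\<bar> \<le> R" "\<bar>b $ i\<bar> \<le> R" for i
    using assms(2) by (auto simp: abs_le_square_iff[symmetric])
  then have "a \<in> cbox (\<chi> i. - R) (\<chi> i. R)" "b \<in> cbox (\<chi> i. - R) (\<chi> i. R)"
    by (auto simp: mem_box_cart abs_le_iff minus_le_iff)
  with t show ?thesis
    unfolding koranyi_box_def cbox_Pair_eq x by auto
qed

lemma pos_pow_gauge4_eq_0:
  assumes "x \<notin> koranyi_box R" "R > 0" "k \<ge> 1"
  shows "pos_pow k (1 - gauge4 x / R ^ 4) = 0"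
proof -
  have "gauge4 x > R ^ 4"
    using mem_koranyi_box_of_gauge4_le[of x R] assms by force
  then have "1 - gauge4 x / R ^ 4 \<le> 0" using \<open>R > 0\<close> by simp
  then show ?thesis using \<open>k \<ge> 1\<close> by (simp add: pos_pow_def)
qed

lemma pos_pow_gauge4_le_1:
  assumes "R > 0"
  shows "pos_pow k (1 - gauge4 x / R ^ 4) \<le> 1"
  using assms gauge4_nonneg[of x] by (auto simp: pos_pow_def intro!: power_le_one)

lemma continuous_on_gauge4 [continuous_intros]: "continuous_on S gauge4"
  unfolding gauge4_def[abs_def] by (intro continuous_intros)

lemma continuous_on_pos_pow_gauge4 [continuous_intros]:
  "continuous_on S (\<lambda>x. pos_pow k (1 - gauge4 x / R ^ 4))"
  unfolding divide_inverse by (intro continuous_intros)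

lemma cutoff_in_C2_0:
  assumes "m \<ge> 1" "R > 0"
  shows "cutoff (Suc (Suc m)) R \<in> C2_0"
proof -
  have "{x. cutoff (Suc (Suc m)) R x \<noteq> 0} \<subseteq> koranyi_box R"
    unfolding cutoff_def using pos_pow_gauge4_eq_0[OF _ \<open>R > 0\<close>] by fastforce
  then have "bounded {x :: 'a heisenberg. cutoff (Suc (Suc m)) R x \<noteq> 0}"
    unfolding koranyi_box_def using bounded_cbox bounded_subset by blast
  then show ?thesis
    using C_k_2_cutoff[OF \<open>m \<ge> 1\<close>] by (simp add: C2_0_def compactly_supported_def)
qed

lemma borel_measurable_lebesgue_continuous:
  fixes f :: "'a::euclidean_space \<Rightarrow> real"
  assumes "continuous_on UNIV f"
  shows "f \<in> borel_measurable lebesgue"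
  using borel_measurable_continuous_onI[OF assms] by (simp add: measurable_completion)

text \<open>Hoelder's inequality for \<open>\<bar>f\<bar> * g\<close> on the box. The weight stays
  inside the norm: \<open>g = \<phi> powr (1 / p)\<close> reproduces the left side of a tested
  equation, and \<open>g = w\<close> yields a quantity tending to 0.\<close>

lemma integral_mult_weight_bound:
  fixes f L g :: "'n::finite heisenberg \<Rightarrow> real"
  assumes "p > 1" "f \<in> Lp p" "K \<ge> 0"
    and g: "g \<in> borel_measurable lebesgue" "\<And>x. 0 \<le> g x" "\<And>x. g x \<le> 1"
    and supp: "\<And>x. x \<notin> koranyi_box R \<Longrightarrow> g x = 0"
    and L: "\<And>x. \<bar>L x\<bar> \<le> K * g x"
  shows "\<bar>LINT x|lebesgue. f x * L x\<bar> \<le>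
    K * ((LINT x|lebesgue. \<bar>f x\<bar> powr p * g x powr p) powr (1 / p)
      * measure lebesgue (koranyi_box R :: 'n heisenberg set) powr (1 - 1 / p))"
proof -
  define h where "h x = \<bar>f x\<bar> * g x" for x
  have f: "f \<in> borel_measurable lebesgue" "integrable lebesgue (\<lambda>x. \<bar>f x\<bar> powr p)"
    using \<open>f \<in> Lp p\<close> by (auto simp: Lp_def)
  have h: "h \<in> borel_measurable lebesgue" "\<And>x. 0 \<le> h x"
    using f g by (auto simp: h_def[abs_def])
  have hp: "h x powr p = \<bar>f x\<bar> powr p * g x powr p" for x
    using g(2) by (simp add: h_def powr_mult)
  have int: "integrable lebesgue (\<lambda>x. h x powr p)"
  proof (rule Bochner_Integration.integrable_bound[OF f(2)])
    show "(\<lambda>x. h x powr p) \<in> borel_measurable lebesgue" using h by measurable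
    have "h x powr p \<le> \<bar>f x\<bar> powr p" for x
      unfolding h_def using g(2,3)[of x] \<open>p > 1\<close> by (intro powr_mono2) (auto simp: mult_left_le)
    then show "AE x in lebesgue. norm (h x powr p) \<le> norm (\<bar>f x\<bar> powr p)" by simp
  qed
  note H = Holder_indicator[OF \<open>p > 1\<close> h int fmeasurable_koranyi_box[of R]]
  have "\<bar>LINT x|lebesgue. f x * L x\<bar> \<le> (LINT x|lebesgue. \<bar>f x * L x\<bar>)"
    by (rule integral_abs_bound)
  also have "\<dots> \<le> (LINT x|lebesgue. K * (h x * indicator (koranyi_box R) x))"
  \<comment> \<open>Only the majorant has to be integrable; a non-integrable left integrand has
    integral 0 by convention.\<close>
  proof (rule integral_mono')
    show "integrable lebesgue (\<lambda>x. K * (h x * indicator (koranyi_box R) x))"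
      using H(1) by simp
    show "\<bar>f x * L x\<bar> \<le> K * (h x * indicator (koranyi_box R) x)" for x
    proof -
      have "\<bar>f x * L x\<bar> \<le> \<bar>f x\<bar> * (K * g x)"
        unfolding abs_mult by (intro mult_left_mono L) simp
      also have "\<dots> = K * (h x * indicator (koranyi_box R) x)"
        using supp[of x] by (auto simp: h_def indicator_def)
      finally show ?thesis .
    qed
  qed (use h \<open>K \<ge> 0\<close> in auto)
  also have "\<dots> = K * (LINT x|lebesgue. h x * indicator (koranyi_box R) x)" by simp
  also have "\<dots> \<le> K * ((LINT x|lebesgue. h x powr p) powr (1 / p)
      * measure lebesgue (koranyi_box R :: 'n heisenberg set) powr (1 - 1 / p))"
    by (intro mult_left_mono H(2) \<open>K \<ge> 0\<close>)
  finally show ?thesis by (simp add: hp)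
qed

text \<open>Dominated convergence with majorant \<open>\<bar>f\<bar> powr p\<close>, used with
  \<open>c = 1\<close> for the cutoffs and \<open>c = 0\<close> for the powers of the
  weights.\<close>

lemma integral_mult_tendsto:
  fixes f :: "'a::euclidean_space \<Rightarrow> real"
  assumes "f \<in> Lp p"
    and g: "\<And>j. g j \<in> borel_measurable lebesgue" "\<And>j x. 0 \<le> g j x" "\<And>j x. g j x \<le> 1"
    and lim: "\<And>x. (\<lambda>j. g j x) \<longlonglongrightarrow> c"
  shows "(\<lambda>j. LINT x|lebesgue. \<bar>f x\<bar> powr p * g j x) \<longlonglongrightarrow> (LINT x|lebesgue. \<bar>f x\<bar> powr p * c)"
proof (rule integral_dominated_convergence[where w = "\<lambda>x. \<bar>f x\<bar> powr p"])
  have f: "f \<in> borel_measurable lebesgue" "integrable lebesgue (\<lambda>x. \<bar>f x\<bar> powr p)"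
    using \<open>f \<in> Lp p\<close> by (auto simp: Lp_def)
  show "integrable lebesgue (\<lambda>x. \<bar>f x\<bar> powr p)" by (rule f)
  show "(\<lambda>x. \<bar>f x\<bar> powr p * c) \<in> borel_measurable lebesgue"
    "\<And>j. (\<lambda>x. \<bar>f x\<bar> powr p * g j x) \<in> borel_measurable lebesgue"
    using f g by auto
  show "AE x in lebesgue. (\<lambda>j. \<bar>f x\<bar> powr p * g j x) \<longlonglongrightarrow> \<bar>f x\<bar> powr p * c"
    by (intro AE_I2 tendsto_intros lim)
  show "AE x in lebesgue. norm (\<bar>f x\<bar> powr p * g j x) \<le> \<bar>f x\<bar> powr p" for j
    using g by (auto simp: abs_mult intro!: mult_left_le)
qed

lemma Lp_zero:
  assumes "f \<in> Lp p" "(LINT x|lebesgue. \<bar>f x\<bar> powr p) \<le> 0"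
  shows "AE x in lebesgue. f x = 0"
proof -
  have "(LINT x|lebesgue. \<bar>f x\<bar> powr p) = 0"
    by (intro antisym assms(2) Bochner_Integration.integral_nonneg) simp
  then have "AE x in lebesgue. \<bar>f x\<bar> powr p = 0"
    using assms(1) by (subst (asm) integral_nonneg_eq_0_iff_AE) (auto simp: Lp_def)
  then show ?thesis by eventually_elim simp
qed

text \<open>On (0, 1] powers decrease in the exponent, so \<open>(m + 2) / p \<le> m\<close>
  suffices, that is \<open>m \<ge> 2 / (p - 1)\<close>.\<close>

lemma exists_cutoff_power:
  assumes "p > (1::real)"
  obtains m where "m \<ge> 1"
    and "\<And>s. s \<le> 1 \<Longrightarrow> pos_pow m s \<le> pos_pow (Suc (Suc m)) s powr (1 / p)"
proof -
  obtain m0 where m0: "2 / (p - 1) \<le> real m0" using real_arch_simple by blast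
  define m where "m = Suc m0"
  have "2 / (p - 1) \<le> real m" using m0 by (simp add: m_def)
  then have m: "real (Suc (Suc m)) * (1 / p) \<le> real m"
    using \<open>p > 1\<close> by (simp add: field_simps)
  have "pos_pow m s \<le> pos_pow (Suc (Suc m)) s powr (1 / p)" if "s \<le> 1" for s
  proof (cases "s > 0")
    case True
    have "pos_pow m s = s powr real m"
      using True by (simp add: pos_pow_def powr_realpow)
    also have "\<dots> \<le> s powr (real (Suc (Suc m)) * (1 / p))"
      using True that by (intro powr_mono' m) auto
    also have "\<dots> = (s powr real (Suc (Suc m))) powr (1 / p)"
      by (rule powr_powr[symmetric])
    also have "s powr real (Suc (Suc m)) = pos_pow (Suc (Suc m)) s"
      unfolding powr_realpow[OF True] using True by (simp add: pos_pow_def)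
    finally show ?thesis .
  next
    case False
    then show ?thesis by (simp add: pos_pow_def m_def)
  qed
  then show ?thesis using that[of m] by (simp add: m_def)
qed

subsection \<open>The system\<close>

text \<open>For a fixed solution the nonlocal coefficients are numbers, here \<open>c1\<close> and
  \<open>c2\<close>. The statement is not symmetric in \<open>p\<close> and \<open>q\<close>: it
  treats one of the two alternatives of the maximum.\<close>

lemma system_trivial:
  fixes u v :: "'n::finite heisenberg \<Rightarrow> real"
  assumes "p > 1" "q > 1" and u: "u \<in> Lp p" and v: "v \<in> Lp q"
    and eq1: "\<And>\<phi>. \<phi> \<in> C2_0 \<Longrightarrow> (\<And>x. 0 \<le> \<phi> x) \<Longrightarrow>
      (LINT x|lebesgue. \<bar>v x\<bar> powr q * \<phi> x)
        = - (LINT x|lebesgue. c1 * u x * kohn_laplacian \<phi> x)"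
    and eq2: "\<And>\<phi>. \<phi> \<in> C2_0 \<Longrightarrow> (\<And>x. 0 \<le> \<phi> x) \<Longrightarrow>
      (LINT x|lebesgue. \<bar>u x\<bar> powr p * \<phi> x)
        = - (LINT x|lebesgue. c2 * v x * kohn_laplacian \<phi> x)"
    and exponent: "(2 * real CARD('n) + 2) * (1 - 1 / (p * q)) \<le> 2 * (1 + 1 / p)"
  shows "AE x in lebesgue. u x = 0 \<and> v x = 0"
proof -
  obtain m where m: "m \<ge> 1"
    "\<And>s. s \<le> 1 \<Longrightarrow> pos_pow m s \<le> pos_pow (Suc (Suc m)) s powr (1 / p)"
    using exists_cutoff_power[OF \<open>p > 1\<close>] by blast
  define K where "K = real (Suc (Suc m)) * (16 * real (Suc m) + 16 + 8 * real CARD('n))"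
  define Q where "Q = 2 * real CARD('n) + 2"
  define V where "V = (2::real) ^ (2 * CARD('n) + 1)"
  \<comment> \<open>The radii are at least 1, so that a nonpositive power of \<open>R j\<close> is
    at most 1.\<close>
  define R where "R j = real (Suc j)" for j
  define \<phi> :: "nat \<Rightarrow> 'n heisenberg \<Rightarrow> real" where "\<phi> j = cutoff (Suc (Suc m)) (R j)" for j
  define w :: "nat \<Rightarrow> 'n heisenberg \<Rightarrow> real" where
    "w j x = horiz x x / (R j)\<^sup>2 * pos_pow m (1 - gauge4 x / R j ^ 4)" for j x
  have K: "K \<ge> 0" and V: "V \<ge> 0" by (auto simp: K_def V_def)
  have R: "R j > 0" "R j \<ge> 1" for j by (auto simp: R_def)
  have R_top: "filterlim R at_top sequentially"
    unfolding R_def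
    by (intro filterlim_compose[OF filterlim_real_sequentially] filterlim_Suc)
  have vol: "measure lebesgue (koranyi_box (R j) :: 'n heisenberg set) = V * R j powr Q" for j
  proof -
    have "R j powr Q = R j powr real (2 * CARD('n) + 2)" by (simp add: Q_def add.commute)
    also have "\<dots> = R j ^ (2 * CARD('n) + 2)" by (rule powr_realpow[OF R(1)])
    finally show ?thesis
      using measure_koranyi_box[of "R j", where 'n = 'n] R(1)[of j] by (simp add: V_def)
  qed
  have \<phi>: "\<phi> j \<in> C2_0" "\<phi> j \<in> borel_measurable lebesgue" "0 \<le> \<phi> j x" "\<phi> j x \<le> 1"
    "x \<notin> koranyi_box (R j) \<Longrightarrow> \<phi> j x = 0" for j x
    using cutoff_in_C2_0[OF m(1) R(1)]
    by (simp_all add: \<phi>_def cutoff_def[abs_def] pos_pow_gauge4_eq_0 pos_pow_gauge4_le_1 R(1)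
        borel_measurable_lebesgue_continuous continuous_on_pos_pow_gauge4)
  have w: "w j \<in> borel_measurable lebesgue" "0 \<le> w j x" "w j x \<le> 1"
    "x \<notin> koranyi_box (R j) \<Longrightarrow> w j x = 0" "w j x \<le> \<phi> j x powr (1 / p)"
    "\<bar>kohn_laplacian (\<phi> j) x\<bar> \<le> K / (R j)\<^sup>2 * w j x" for j x
  proof -
    let ?P = "pos_pow m (1 - gauge4 x / R j ^ 4)"
    show "w j \<in> borel_measurable lebesgue"
      unfolding w_def[abs_def] divide_inverse
      by (intro borel_measurable_lebesgue_continuous continuous_intros)
    show "0 \<le> w j x" by (simp add: w_def horiz_self_nonneg)
    have le_P: "w j x \<le> ?P"
    proof (cases "gauge4 x \<le> R j ^ 4")
      case True
      then have "horiz x x / (R j)\<^sup>2 \<le> 1"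
        using horiz_le_of_gauge4_le R(1)[of j] by simp
      then show ?thesis
        unfolding w_def by (intro mult_left_le_one_le) (auto simp: horiz_self_nonneg)
    next
      case False
      then have "1 - gauge4 x / R j ^ 4 \<le> 0" using R(1)[of j] by simp
      then have "?P = 0" using m(1) by (simp add: pos_pow_def)
      then show ?thesis by (simp add: w_def)
    qed
    then show "w j x \<le> 1"
      using pos_pow_gauge4_le_1[OF R(1), of m x j] by linarith
    show "w j x = 0" if "x \<notin> koranyi_box (R j)"
      using pos_pow_gauge4_eq_0[OF that R(1) m(1)] by (simp add: w_def)
    have "?P \<le> \<phi> j x powr (1 / p)"
      unfolding \<phi>_def cutoff_def using gauge4_nonneg[of x] R(1)[of j] by (intro m(2)) simp
    with le_P show "w j x \<le> \<phi> j x powr (1 / p)" by linarith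
    have "K / (R j)\<^sup>2 * w j x = K * (horiz x x / R j ^ 4) * ?P"
      by (simp add: w_def power2_eq_square power4_eq_xxxx)
    then show "\<bar>kohn_laplacian (\<phi> j) x\<bar> \<le> K / (R j)\<^sup>2 * w j x"
      using kohn_laplacian_cutoff_bound[OF m(1) R(1), of j x] unfolding \<phi>_def K_def by simp
  qed
  define A where "A j = (LINT x|lebesgue. \<bar>v x\<bar> powr q * \<phi> j x)" for j
  define B where "B j = (LINT x|lebesgue. \<bar>u x\<bar> powr p * \<phi> j x)" for j
  define E where "E j = (LINT x|lebesgue. \<bar>v x\<bar> powr q * w j x powr q)" for j
  have nonneg: "0 \<le> A j" "0 \<le> B j" "0 \<le> E j" for j
    unfolding A_def B_def E_def
    by (auto intro!: Bochner_Integration.integral_nonneg simp: \<phi>(3))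
  \<comment> \<open>The weight is enlarged from \<open>w\<close> to
    \<open>\<phi> powr (1 / p)\<close>, whose p-th power is \<open>\<phi>\<close>, so that
    \<open>B\<close> reappears on the right.\<close>
  have A_le: "A j \<le> \<bar>c1\<bar> * (K / (R j)\<^sup>2 * (B j powr (1 / p) * (V * R j powr Q) powr (1 - 1 / p)))" for j
  proof -
    have "A j = - (c1 * (LINT x|lebesgue. u x * kohn_laplacian (\<phi> j) x))"
      unfolding A_def eq1[OF \<phi>(1,3)] by (simp add: mult.assoc)
    also have "\<dots> \<le> \<bar>c1\<bar> * \<bar>LINT x|lebesgue. u x * kohn_laplacian (\<phi> j) x\<bar>"
      unfolding abs_mult[symmetric] by (rule abs_ge_minus_self)
    also have "\<bar>LINT x|lebesgue. u x * kohn_laplacian (\<phi> j) x\<bar> \<le> K / (R j)\<^sup>2 *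
      ((LINT x|lebesgue. \<bar>u x\<bar> powr p * (\<phi> j x powr (1 / p)) powr p) powr (1 / p)
      * measure lebesgue (koranyi_box (R j) :: 'n heisenberg set) powr (1 - 1 / p))"
    proof (rule integral_mult_weight_bound[OF \<open>p > 1\<close> u])
      show "\<bar>kohn_laplacian (\<phi> j) x\<bar> \<le> K / (R j)\<^sup>2 * \<phi> j x powr (1 / p)" for x
        by (rule order_trans[OF w(6)]) (intro mult_left_mono w(5), use K in simp)
      show "\<phi> j x powr (1 / p) \<le> 1" for x
        using \<phi>(3,4)[of j x] \<open>p > 1\<close> by (intro powr_le1) auto
    qed (use \<phi> K in auto)
    also have "(\<lambda>x. (\<phi> j x powr (1 / p)) powr p) = \<phi> j"
      using \<phi>(3) \<open>p > 1\<close> by (simp add: powr_powr fun_eq_iff)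
    finally show ?thesis
      unfolding vol B_def by (simp add: mult_left_mono)
  qed
  \<comment> \<open>Here the smaller weight \<open>w\<close> is kept: the right side contains
    \<open>E\<close>, which tends to 0, instead of \<open>A\<close>.\<close>
  have B_le: "B j \<le> \<bar>c2\<bar> * (K / (R j)\<^sup>2 * (E j powr (1 / q) * (V * R j powr Q) powr (1 - 1 / q)))" for j
  proof -
    have "B j = - (c2 * (LINT x|lebesgue. v x * kohn_laplacian (\<phi> j) x))"
      unfolding B_def eq2[OF \<phi>(1,3)] by (simp add: mult.assoc)
    also have "\<dots> \<le> \<bar>c2\<bar> * \<bar>LINT x|lebesgue. v x * kohn_laplacian (\<phi> j) x\<bar>"
      unfolding abs_mult[symmetric] by (rule abs_ge_minus_self)
    also have "\<bar>LINT x|lebesgue. v x * kohn_laplacian (\<phi> j) x\<bar> \<le> K / (R j)\<^sup>2 *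
      ((LINT x|lebesgue. \<bar>v x\<bar> powr q * w j x powr q) powr (1 / q)
      * measure lebesgue (koranyi_box (R j) :: 'n heisenberg set) powr (1 - 1 / q))"
      by (rule integral_mult_weight_bound[OF \<open>q > 1\<close> v]) (use w K in auto)
    finally show ?thesis
      unfolding vol E_def by (simp add: mult_left_mono)
  qed
  define D where "D = \<bar>c1\<bar> * K * V powr (1 - 1 / p) * (\<bar>c2\<bar> * K * V powr (1 - 1 / q)) powr (1 / p)"
  have A_le_E: "A j \<le> D * E j powr (1 / q * (1 / p))" for j
  proof -
    let ?r = "R j"
    have pw: "K / ?r\<^sup>2 = K * ?r powr (-2)"
      using R(1)[of j] by (simp add: powr_minus_divide)
    have vp: "(V * ?r powr Q) powr s = V powr s * ?r powr (Q * s)" for s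
      using V by (simp add: powr_mult powr_powr)
    have Q2: "?r powr (-2) * ?r powr s = ?r powr (s - 2)" for s
      by (simp add: powr_add[symmetric])
    have pm: "(a * ?r powr s * E j powr t) powr z = a powr z * ?r powr (s * z) * E j powr (t * z)" for a s t z
      by (simp add: powr_mult powr_powr)
    have "B j powr (1 / p) \<le>
        (\<bar>c2\<bar> * K * V powr (1 - 1 / q) * (?r powr (-2) * ?r powr (Q * (1 - 1 / q))) * E j powr (1 / q)) powr (1 / p)"
    proof (rule powr_mono2)
      show "B j \<le> \<bar>c2\<bar> * K * V powr (1 - 1 / q) * (?r powr (-2) * ?r powr (Q * (1 - 1 / q))) * E j powr (1 / q)"
        using B_le[of j] unfolding pw vp by (simp only: mult_ac)
    qed (use nonneg \<open>p > 1\<close> in auto)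
    also have "\<dots> = (\<bar>c2\<bar> * K * V powr (1 - 1 / q)) powr (1 / p) *
        ?r powr ((Q * (1 - 1 / q) - 2) * (1 / p)) * E j powr (1 / q * (1 / p))"
      unfolding Q2 by (rule pm)
    finally have B': "B j powr (1 / p) \<le> (\<bar>c2\<bar> * K * V powr (1 - 1 / q)) powr (1 / p) *
        ?r powr ((Q * (1 - 1 / q) - 2) * (1 / p)) * E j powr (1 / q * (1 / p))" .
    have "A j \<le> \<bar>c1\<bar> * K * V powr (1 - 1 / p) * (?r powr (-2) * ?r powr (Q * (1 - 1 / p))) * B j powr (1 / p)"
      using A_le[of j] unfolding pw vp by (simp only: mult_ac)
    also have "\<dots> \<le> \<bar>c1\<bar> * K * V powr (1 - 1 / p) * (?r powr (-2) * ?r powr (Q * (1 - 1 / p))) *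
       ((\<bar>c2\<bar> * K * V powr (1 - 1 / q)) powr (1 / p) *
        ?r powr ((Q * (1 - 1 / q) - 2) * (1 / p)) * E j powr (1 / q * (1 / p)))"
      by (intro mult_left_mono B') (use K in auto)
    also have "\<dots> = ?r powr (-2 + Q * (1 - 1 / p) + (Q * (1 - 1 / q) - 2) * (1 / p)) *
        (D * E j powr (1 / q * (1 / p)))"
      unfolding powr_add D_def by (simp only: mult_ac)
    also have "\<dots> \<le> 1 * (D * E j powr (1 / q * (1 / p)))"
    proof (rule mult_right_mono)
      \<comment> \<open>The total exponent of \<open>R j\<close> is the difference of the two sides
        of the exponent condition. No decay in \<open>R j\<close> is required, as the decay comes
        from \<open>E\<close>; this covers equality.\<close>
      have "-2 + Q * (1 - 1 / p) + (Q * (1 - 1 / q) - 2) * (1 / p)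
          = Q * (1 - 1 / (p * q)) - 2 * (1 + 1 / p)"
        using \<open>p > 1\<close> \<open>q > 1\<close> by (simp add: field_simps)
      also have "\<dots> \<le> 0" using exponent by (simp add: Q_def)
      finally have le: "-2 + Q * (1 - 1 / p) + (Q * (1 - 1 / q) - 2) * (1 / p) \<le> 0" .
      have "?r powr (-2 + Q * (1 - 1 / p) + (Q * (1 - 1 / q) - 2) * (1 / p)) \<le> ?r powr 0"
        by (rule powr_mono[OF le R(2)])
      also have "\<dots> = 1"
        using R(1)[of j] by simp
      finally show "?r powr (-2 + Q * (1 - 1 / p) + (Q * (1 - 1 / q) - 2) * (1 / p)) \<le> 1" .
    qed (use K in \<open>simp add: D_def\<close>)
    finally show ?thesis by simp
  qed
  have inv_lim: "(\<lambda>j. c / R j ^ k) \<longlonglongrightarrow> 0" if "k > 0" for c :: real and k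
    using that by (intro tendsto_divide_0[OF tendsto_const] filterlim_at_top_imp_at_infinity
        filterlim_pow_at_top R_top)
  have P_lim: "(\<lambda>j. pos_pow k (1 - gauge4 x / R j ^ 4)) \<longlonglongrightarrow> 1" for k and x :: "'n heisenberg"
  proof -
    have "(\<lambda>j. max 0 (1 - gauge4 x / R j ^ 4) ^ k) \<longlonglongrightarrow> max 0 (1 - 0) ^ k"
      by (intro tendsto_intros inv_lim) simp
    then show ?thesis by (simp add: pos_pow_def)
  qed
  have \<phi>_lim: "(\<lambda>j. \<phi> j x) \<longlonglongrightarrow> 1" for x
    using P_lim by (simp add: \<phi>_def cutoff_def)
  have w_lim: "(\<lambda>j. w j x) \<longlonglongrightarrow> 0" for x
    using tendsto_mult[OF inv_lim[of 2 "horiz x x"] P_lim[of m x]] by (simp add: w_def)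
  have "E \<longlonglongrightarrow> (LINT x|lebesgue. \<bar>v x\<bar> powr q * 0)"
    unfolding E_def[abs_def]
  proof (rule integral_mult_tendsto[OF v])
    show "(\<lambda>j. w j x powr q) \<longlonglongrightarrow> 0" for x
      by (rule tendsto_zero_powrI[OF w_lim tendsto_const]) (use \<open>q > 1\<close> w(2) in auto)
    show "w j x powr q \<le> 1" for j x
      using w(2,3) \<open>q > 1\<close> by (intro powr_le1) auto
  qed (use w in auto)
  then have E_lim: "E \<longlonglongrightarrow> 0" by simp
  have "(\<lambda>j. D * E j powr (1 / q * (1 / p))) \<longlonglongrightarrow> D * 0"
    by (intro tendsto_mult tendsto_const tendsto_zero_powrI[OF E_lim tendsto_const])
      (use nonneg \<open>p > 1\<close> \<open>q > 1\<close> in auto)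
  moreover have A_lim: "A \<longlonglongrightarrow> (LINT x|lebesgue. \<bar>v x\<bar> powr q * 1)"
    unfolding A_def[abs_def]
    by (rule integral_mult_tendsto[OF v \<phi>(2-4) \<phi>_lim])
  ultimately have "(LINT x|lebesgue. \<bar>v x\<bar> powr q) \<le> 0"
    using LIMSEQ_le[of A _ "\<lambda>j. D * E j powr (1 / q * (1 / p))" "D * 0"] A_le_E by auto
  then have v0: "AE x in lebesgue. v x = 0" by (rule Lp_zero[OF v])
  \<comment> \<open>The estimates gave only \<open>v = 0\<close>. The second equation then makes
    every \<open>B j\<close> zero, and their limit is the integral of
    \<open>\<bar>u\<bar> powr p\<close>.\<close>
  have "B = (\<lambda>j. 0)"
  proof
    fix j
    have "(LINT x|lebesgue. c2 * v x * kohn_laplacian (\<phi> j) x) = 0"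
      by (rule integral_eq_zero_AE) (use v0 in eventually_elim, simp)
    then show "B j = 0" unfolding B_def eq2[OF \<phi>(1,3)] by simp
  qed
  moreover have "B \<longlonglongrightarrow> (LINT x|lebesgue. \<bar>u x\<bar> powr p * 1)"
    unfolding B_def[abs_def]
    by (rule integral_mult_tendsto[OF u \<phi>(2-4) \<phi>_lim])
  ultimately have "(LINT x|lebesgue. \<bar>u x\<bar> powr p) \<le> 0"
    by (simp add: LIMSEQ_const_iff)
  then have "AE x in lebesgue. u x = 0" by (rule Lp_zero[OF u])
  with v0 show ?thesis by eventually_elim simp
qed

theorem theorem2p4:
  fixes M1 M2 :: "real \<Rightarrow> real \<Rightarrow> real" and C1 C2 p q Q :: real
  assumes "Q = 2 * real CARD('n::finite) + 2"
    and "p > 1" and "q > 1"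
    and "\<And>s t. s \<ge> 0 \<Longrightarrow> t \<ge> 0 \<Longrightarrow> 0 < M1 s t \<and> M1 s t \<le> C1"
    and "\<And>s t. s \<ge> 0 \<Longrightarrow> t \<ge> 0 \<Longrightarrow> 0 < M2 s t \<and> M2 s t \<le> C2"
    and "Q * (1 - 1 / (p * q)) \<le> 2 * max (1 + 1 / q) (1 + 1 / p)"
  shows "\<not> (\<exists>u v :: 'n heisenberg \<Rightarrow> real.
           weak_solution M1 M2 p q u v \<and> \<not> (AE x in lebesgue. u x = 0 \<and> v x = 0))"
proof clarify
  fix u v :: "'n heisenberg \<Rightarrow> real"
  assume sol: "weak_solution M1 M2 p q u v"
    and nontriv: "\<not> (AE x in lebesgue. u x = 0 \<and> v x = 0)"
  let ?c1 = "M1 (gradient_energy u) (laplacian_energy u)"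
  let ?c2 = "M2 (gradient_energy v) (laplacian_energy v)"
  have L: "u \<in> Lp p" "v \<in> Lp q"
    using sol by (auto simp: weak_solution_def)
  have eqs: "(LINT x|lebesgue. \<bar>v x\<bar> powr q * \<phi> x)
        = - (LINT x|lebesgue. ?c1 * u x * kohn_laplacian \<phi> x)"
      "(LINT x|lebesgue. \<bar>u x\<bar> powr p * \<phi> x)
        = - (LINT x|lebesgue. ?c2 * v x * kohn_laplacian \<phi> x)"
    if "\<phi> \<in> C2_0" "\<And>x. 0 \<le> \<phi> x" for \<phi>
    using sol that by (auto simp: weak_solution_def)
  \<comment> \<open>One alternative for each entry of the maximum. The second is written with
    \<open>q * p\<close>, the form it takes after exchanging the roles of the two unknowns.\<close>
  consider "(2 * real CARD('n) + 2) * (1 - 1 / (p * q)) \<le> 2 * (1 + 1 / p)"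
    | "(2 * real CARD('n) + 2) * (1 - 1 / (q * p)) \<le> 2 * (1 + 1 / q)"
    using assms(1,6) by (auto simp: max_def mult.commute split: if_splits)
  then have "AE x in lebesgue. u x = 0 \<and> v x = 0"
  proof cases
    case 1
    show ?thesis
      by (rule system_trivial[OF assms(2,3) L eqs 1])
  next
    case 2
    have "AE x in lebesgue. v x = 0 \<and> u x = 0"
      by (rule system_trivial[OF assms(3,2) L(2,1) eqs(2,1) 2])
    then show ?thesis by eventually_elim simp
  qed
  with nontriv show False by blast
qed

end
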